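(* Let $G$ be a connected graph of order $n$ with diameter $d$ and radius $r$, and let $Z(G)=\{x_1,\ldots,x_t\}$ ($t\geqslant 1$) be the center of $G$. Then for every integer $i$ with $0\leqslant i\leqslant d-r$, $$D(G^{r+i})\geqslant \big|\{x\in V(G) : 0\leqslant d_G(x_j,x)\leqslant i \text{ for some } j\in\{1,\ldots,t\}\}\big|.$$
   Context: All graphs are finite and simple. The eccentricity of a vertex $x$ is $\max_{u\in V(G)} d_G(x,u)$; the radius and diameter are the minimum and maximum eccentricities; the center $Z(G)$ is the set of vertices of eccentricity equal to the radius. The distinguishing number $D(H)$ is the least $d$ such that some labeling $V(H)\to\{1,\dots,d\}$ is preserved by no non-trivial automorphism of $H$. The $m$-th power $G^m$ is the graph on $V(G)$ in which distinct $x,y$ are adjacent iff $1\leqslant d_G(x,y)\leqslant m$. *)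

theory Defs
  imports Graph_Theory.Graph_Theory
begin

text \<open>
  A finite simple graph is a \<^locale>\<open>pair_graph\<close>: an undirected edge is represented by its two
  opposite arcs.
\<close>

text \<open>The library's weighted distance with all weights 1; it is \<open>\<infinity>\<close> between different components.\<close>

definition gdist :: "'a pair_pre_digraph \<Rightarrow> 'a \<Rightarrow> 'a \<Rightarrow> ereal" where
  "gdist G u v = wf_digraph.\<mu> (with_proj G) (\<lambda>_. 1) u v"

definition eccentricity :: "'a pair_pre_digraph \<Rightarrow> 'a \<Rightarrow> ereal" where
  "eccentricity G x = Max (gdist G x ` pverts G)"

definition radius :: "'a pair_pre_digraph \<Rightarrow> ereal" where
  "radius G = Min (eccentricity G ` pverts G)"

definition diameter :: "'a pair_pre_digraph \<Rightarrow> ereal" where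
  "diameter G = Max (eccentricity G ` pverts G)"

definition center :: "'a pair_pre_digraph \<Rightarrow> 'a set" where
  "center G = {x \<in> pverts G. eccentricity G x = radius G}"

definition graph_power :: "'a pair_pre_digraph \<Rightarrow> nat \<Rightarrow> 'a pair_pre_digraph" where
  "graph_power G m = \<lparr> pverts = pverts G,
     parcs = {(x, y). x \<in> pverts G \<and> y \<in> pverts G \<and> x \<noteq> y \<and>
                      1 \<le> gdist G x y \<and> gdist G x y \<le> ereal (real m)} \<rparr>"

text \<open>
  Only the values of \<open>\<phi>\<close> on the vertices matter. The library's isomorphisms carry an additional
  map on arcs, which for pair graphs is determined by the map on vertices; see
  \<open>automorphism_iff\<close> below.
\<close>

definition automorphism :: "'a pair_pre_digraph \<Rightarrow> ('a \<Rightarrow> 'a) \<Rightarrow> bool" where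
  "automorphism H \<phi> \<longleftrightarrow>
     (\<exists>f. pre_digraph.digraph_isomorphism (with_proj H) f \<and>
          app_iso f (with_proj H) = with_proj H \<and> iso_verts f = \<phi>)"

definition distinguishing_labeling :: "'a pair_pre_digraph \<Rightarrow> nat \<Rightarrow> ('a \<Rightarrow> nat) \<Rightarrow> bool" where
  "distinguishing_labeling H k c \<longleftrightarrow>
     c \<in> pverts H \<rightarrow> {1..k} \<and>
     (\<forall>\<phi>. automorphism H \<phi> \<and> (\<forall>v \<in> pverts H. c (\<phi> v) = c v) \<longrightarrow> (\<forall>v \<in> pverts H. \<phi> v = v))"

definition distinguishing_number :: "'a pair_pre_digraph \<Rightarrow> nat" where
  "distinguishing_number H = (LEAST k. \<exists>c. distinguishing_labeling H k c)"

lemma gdist_le_iff: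
  assumes "pair_graph G"
  shows "gdist G u v \<le> ereal (real m) \<longleftrightarrow>
    (\<exists>p. pre_digraph.awalk (with_proj G) u p v \<and> length p \<le> m)"
proof -
  interpret pair_graph G by fact
  have cost: "awalk_cost (\<lambda>_. 1) p = real (length p)" for p :: "('a \<times> 'a) list"
    by (induction p) (auto simp: awalk_cost_def)
  have mu: "gdist G u v = (INF p \<in> {p. awalk u p v}. ereal (real (length p)))"
    by (simp add: gdist_def \<mu>_def cost)
  show ?thesis
  proof
    assume le: "gdist G u v \<le> ereal (real m)"
    also have "\<dots> < ereal (real m + 1)" by simp
    finally obtain p where "awalk u p v" "ereal (real (length p)) < ereal (real m + 1)"
      unfolding mu INF_less_iff by auto
    then show "\<exists>p. awalk u p v \<and> length p \<le> m" by (auto intro!: exI[of _ p])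
  next
    assume "\<exists>p. awalk u p v \<and> length p \<le> m"
    then show "gdist G u v \<le> ereal (real m)"
      unfolding mu by (auto intro: INF_lower2)
  qed
qed

lemma pair_graph_graph_power:
  assumes "pair_graph G"
  shows "pair_graph (graph_power G m)"
proof -
  interpret pair_graph G by fact
  have rev: "gdist G y x \<le> ereal (real k)" if "gdist G x y \<le> ereal (real k)" for x y k
  proof -
    from that obtain p where "awalk x p y" "length p \<le> k"
      using gdist_le_iff[OF assms] by blast
    moreover have "length (rev_path p) = length p" by (induction p) auto
    ultimately show ?thesis
      using gdist_le_iff[OF assms] awalk_rev_path by metis
  qed
  have rev1: "1 \<le> gdist G y x" if "1 \<le> gdist G x y" "x \<noteq> y" for x y
  proof (rule ccontr)
    assume "\<not> 1 \<le> gdist G y x"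
    then obtain p where p: "awalk y p x" "awalk_cost (\<lambda>_. 1) p < (1::real)"
      by (auto simp: gdist_def \<mu>_def not_le INF_less_iff)
    with \<open>x \<noteq> y\<close> have "p \<noteq> []" by auto
    then have "awalk_cost (\<lambda>_. 1) p \<ge> (1::real)"
      by (cases p) (auto simp: awalk_cost_def intro!: sum_list_nonneg)
    with p show False by simp
  qed
  let ?P = "graph_power G m"
  have sub: "parcs ?P \<subseteq> pverts G \<times> pverts G" by (auto simp: graph_power_def)
  show ?thesis
  proof
    show "symmetric (with_proj ?P)"
      by (auto simp: symmetric_def sym_def graph_power_def intro: rev rev1)
    show "finite (parcs ?P)"
      using sub finite_verts by (meson finite_SigmaI finite_subset)
  qed (use finite_verts in \<open>auto simp: graph_power_def\<close>)
qed

lemma automorphism_iff: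
  assumes "pair_graph H"
  shows "automorphism H \<phi> \<longleftrightarrow>
    bij_betw \<phi> (pverts H) (pverts H) \<and>
    (\<forall>u \<in> pverts H. \<forall>v \<in> pverts H. (u, v) \<in> parcs H \<longleftrightarrow> (\<phi> u, \<phi> v) \<in> parcs H)"
proof -
  interpret pair_graph H by fact
  show ?thesis
  proof (intro iffI conjI)
    assume "automorphism H \<phi>"
    then obtain f where iso: "digraph_isomorphism f" and
      app: "app_iso f (with_proj H) = with_proj H" and f: "iso_verts f = \<phi>"
      by (auto simp: automorphism_def)
    from app have V: "\<phi> ` pverts H = pverts H" and A: "iso_arcs f ` parcs H = parcs H"
      and t: "iso_tail f = fst" and h: "iso_head f = snd"
      by (auto simp: app_iso_def with_proj_def f)
    have inj: "inj_on \<phi> (pverts H)"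
      using iso by (auto simp: digraph_isomorphism_def f)
    then show "bij_betw \<phi> (pverts H) (pverts H)" using V by (simp add: bij_betw_def)
    have arc: "iso_arcs f (u, v) = (\<phi> u, \<phi> v)" if "(u, v) \<in> parcs H" for u v
      using iso that by (auto simp: digraph_isomorphism_def f t h prod_eq_iff)
    show "\<forall>u \<in> pverts H. \<forall>v \<in> pverts H. (u, v) \<in> parcs H \<longleftrightarrow> (\<phi> u, \<phi> v) \<in> parcs H"
    proof (intro ballI iffI)
      fix u v assume "(u, v) \<in> parcs H"
      then show "(\<phi> u, \<phi> v) \<in> parcs H" using arc A by (metis imageI)
    next
      fix u v assume uv: "u \<in> pverts H" "v \<in> pverts H" "(\<phi> u, \<phi> v) \<in> parcs H"
      then obtain a b where ab: "(a, b) \<in> parcs H" "(\<phi> u, \<phi> v) = iso_arcs f (a, b)"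
        using A by (metis imageE surj_pair)
      then have "\<phi> a = \<phi> u" "\<phi> b = \<phi> v" "a \<in> pverts H" "b \<in> pverts H"
        using arc wellformed' by auto
      then have "a = u" "b = v" using inj uv by (auto dest: inj_onD)
      then show "(u, v) \<in> parcs H" using ab by simp
    qed
  next
    assume R: "bij_betw \<phi> (pverts H) (pverts H) \<and>
      (\<forall>u \<in> pverts H. \<forall>v \<in> pverts H. (u, v) \<in> parcs H \<longleftrightarrow> (\<phi> u, \<phi> v) \<in> parcs H)"
    let ?f = "\<lparr> iso_verts = \<phi>, iso_arcs = map_prod \<phi> \<phi>, iso_head = snd, iso_tail = fst \<rparr>"
    have V: "\<phi> ` pverts H = pverts H" and inj: "inj_on \<phi> (pverts H)"
      using R by (auto simp: bij_betw_def)
    have sub: "parcs H \<subseteq> pverts H \<times> pverts H" using wellformed' by auto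
    have A: "map_prod \<phi> \<phi> ` parcs H = parcs H"
    proof (intro equalityI subsetI)
      fix e assume "e \<in> map_prod \<phi> \<phi> ` parcs H"
      then show "e \<in> parcs H" using R sub by fastforce
    next
      fix e assume e: "e \<in> parcs H"
      obtain x y where xy: "e = (x, y)" by (cases e)
      then have "x \<in> \<phi> ` pverts H" "y \<in> \<phi> ` pverts H" using V e sub by auto
      then obtain u v where uv: "u \<in> pverts H" "v \<in> pverts H" "x = \<phi> u" "y = \<phi> v" by auto
      then have "(u, v) \<in> parcs H" using R e xy by auto
      then show "e \<in> map_prod \<phi> \<phi> ` parcs H" using uv xy by force
    qed
    have "inj_on (map_prod \<phi> \<phi>) (parcs H)"
      using map_prod_inj_on[OF inj inj] sub by (rule inj_on_subset)
    then have "digraph_isomorphism ?f"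
      using inj wf_digraph_wp_iff pair_wf_digraph
      by (auto simp: digraph_isomorphism_def)
    moreover have "app_iso ?f (with_proj H) = with_proj H"
      using V A by (simp add: app_iso_def with_proj_def)
    ultimately show "automorphism H \<phi>" unfolding automorphism_def by force
  qed
qed

end

theory Submission
  imports Defs "HOL-Combinatorics.Permutations"
begin

text \<open>
  A vertex within distance \<open>i\<close> of the center has eccentricity at most \<open>r + i\<close>, so it is adjacent to
  every other vertex of the power \<open>r + i\<close>. Transposing two such vertices is an automorphism,
  so a distinguishing labeling is injective on the set of all of them.
\<close>

text \<open>Both \<open>a\<close> and \<open>b\<close> are adjacent to every other vertex, so they
  have the same neighbours outside \<open>{a, b}\<close>, and exchanging them changes no
  adjacency.\<close>

lemma automorphism_transpose_universal:
  assumes "pair_graph H" and "a \<in> pverts H" "b \<in> pverts H"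
    and adj: "\<And>v. v \<in> pverts H - {a} \<Longrightarrow> (a, v) \<in> parcs H" "\<And>v. v \<in> pverts H - {b} \<Longrightarrow> (b, v) \<in> parcs H"
  shows "automorphism H (transpose a b)"
proof -
  interpret pair_graph H by fact
  have sym: "(v, u) \<in> parcs H" if "(u, v) \<in> parcs H" for u v
    using that by (simp add: arcs_symmetric)
  have loop: "(u, u) \<notin> parcs H" for u
    using no_loops' by blast
  have "transpose a b permutes pverts H"
    using assms(2,3) by (simp add: permutes_swap_id)
  then have "bij_betw (transpose a b) (pverts H) (pverts H)"
    by (rule permutes_imp_bij)
  moreover have "(u, v) \<in> parcs H \<longleftrightarrow> (transpose a b u, transpose a b v) \<in> parcs H"
    if "u \<in> pverts H" "v \<in> pverts H" for u v
  proof -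
    \<comment> \<open>Arcs meeting \<open>a\<close> or \<open>b\<close> reduce to distinctness of
      endpoints; after unfolding \<open>transpose\<close>, only arcs avoiding both remain, and these
      are fixed.\<close>
    have "(a, v) \<in> parcs H \<longleftrightarrow> v \<noteq> a" "(v, a) \<in> parcs H \<longleftrightarrow> v \<noteq> a"
      "(b, v) \<in> parcs H \<longleftrightarrow> v \<noteq> b" "(v, b) \<in> parcs H \<longleftrightarrow> v \<noteq> b" if "v \<in> pverts H" for v
      using that adj sym loop by blast+
    then show ?thesis
      using that assms(2,3) by (simp add: transpose_def)
  qed
  ultimately show ?thesis
    using automorphism_iff[OF assms(1)] by blast
qed

lemma distinguishing_labeling_inj_on_universal:
  assumes "pair_graph H" and lab: "distinguishing_labeling H k c" and "S \<subseteq> pverts H"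
    and adj: "\<And>a v. a \<in> S \<Longrightarrow> v \<in> pverts H - {a} \<Longrightarrow> (a, v) \<in> parcs H"
  shows "inj_on c S"
proof (rule inj_onI)
  fix a b assume ab: "a \<in> S" "b \<in> S" "c a = c b"
  have "automorphism H (transpose a b)"
    using ab adj assms(3) by (intro automorphism_transpose_universal[OF assms(1)]) auto
  moreover have "c (transpose a b v) = c v" for v
    using ab(3) by (simp add: transpose_def)
  ultimately have "\<forall>v \<in> pverts H. transpose a b v = v"
    using lab unfolding distinguishing_labeling_def by blast
  \<comment> \<open>Evaluating at \<open>v = a\<close> gives \<open>b = a\<close>.\<close>
  then show "a = b" using ab(1) assms(3) by fastforce
qed

text \<open>Giving all vertices different labels leaves only the identity on vertices. This makes
  the \<open>LEAST\<close> in \<open>distinguishing_number\<close> an attained value.\<close>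

lemma ex_distinguishing_labeling:
  assumes "pair_graph H"
  shows "\<exists>k c. distinguishing_labeling H k c"
proof -
  interpret pair_graph H by fact
  obtain c where c: "bij_betw c (pverts H) {1..card (pverts H)}"
    using ex_bij_betw_finite_nat ex_bij_betw_nat_finite_1[of "pverts H"] finite_verts bij_betw_inv
    by (metis with_proj_simps(1))
  have "\<phi> v = v"
    if "automorphism H \<phi>" "\<forall>v \<in> pverts H. c (\<phi> v) = c v" "v \<in> pverts H" for \<phi> v
  proof -
    have "\<phi> v \<in> pverts H"
      using that automorphism_iff[OF assms] by (auto dest: bij_betwE)
    then show ?thesis
      using that c by (auto simp: bij_betw_def dest: inj_onD)
  qed
  then have "distinguishing_labeling H (card (pverts H)) c"
    using c by (auto simp: distinguishing_labeling_def dest: bij_betwE)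
  then show ?thesis by blast
qed

text \<open>An optimal labeling is injective on \<open>S\<close> and takes at most
  \<open>distinguishing_number H\<close> values there.\<close>

lemma card_universal_le_distinguishing_number:
  assumes "pair_graph H" and "S \<subseteq> pverts H"
    and adj: "\<And>a v. a \<in> S \<Longrightarrow> v \<in> pverts H - {a} \<Longrightarrow> (a, v) \<in> parcs H"
  shows "card S \<le> distinguishing_number H"
proof -
  obtain c where c: "distinguishing_labeling H (distinguishing_number H) c"
    unfolding distinguishing_number_def
    using LeastI_ex[OF ex_distinguishing_labeling[OF assms(1)]] by blast
  then have "c ` S \<subseteq> {1..distinguishing_number H}"
    using assms(2) by (auto simp: distinguishing_labeling_def)
  moreover have "inj_on c S"
    using distinguishing_labeling_inj_on_universal[OF assms(1) c assms(2) adj] .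
  ultimately show ?thesis
    using card_inj_on_le[of c S "{1..distinguishing_number H}"] by simp
qed

text \<open>Every walk between distinct vertices has at least one arc, and the bound passes to the
  infimum over walks. It supplies the lower bound in \<open>graph_power\<close>.\<close>

lemma gdist_ge_1:
  assumes "pair_graph G" and "u \<noteq> v"
  shows "1 \<le> gdist G u v"
proof -
  interpret pair_graph G by fact
  have "(1::ereal) \<le> ereal (awalk_cost (\<lambda>_. 1) p)" if "awalk u p v" for p
  proof -
    have "p \<noteq> []" using that assms(2) by auto
    then show ?thesis
      by (cases p) (auto simp: awalk_cost_def intro!: sum_list_nonneg)
  qed
  then show ?thesis
    by (auto simp: gdist_def \<mu>_def intro!: INF_greatest)
qed

text \<open>Reverse a short walk from \<open>w\<close> to \<open>u\<close> and append one from
  \<open>w\<close> to \<open>v\<close>. Both bounds start at \<open>w\<close> because a central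
  vertex will take its place.\<close>

lemma gdist_triangle_le:
  assumes "pair_graph G" and "gdist G w u \<le> ereal (real l)" and "gdist G w v \<le> ereal (real m)"
  shows "gdist G u v \<le> ereal (real (m + l))"
proof -
  interpret pair_graph G by fact
  obtain p q where p: "awalk w p u" "length p \<le> l" and q: "awalk w q v" "length q \<le> m"
    using assms(2,3) gdist_le_iff[OF assms(1)] by blast
  have "awalk u (rev_path p @ q) v"
    using p q awalk_rev_path by (intro awalk_appendI) auto
  moreover have "length (rev_path p) = length p" by (induction p) auto
  ultimately show ?thesis
    using p q gdist_le_iff[OF assms(1)] by (metis add.commute add_mono length_append)
qed

lemma gdist_center_le_radius:
  assumes "pair_graph G" and "w \<in> center G" and "v \<in> pverts G"
  shows "gdist G w v \<le> radius G"
proof -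
  interpret pair_graph G by fact
  have "gdist G w v \<le> eccentricity G w"
    unfolding eccentricity_def using finite_verts assms(3) by (intro Max_ge) auto
  then show ?thesis using assms(2) by (simp add: center_def)
qed

theorem theorem2p4:
  fixes G :: "'a pair_pre_digraph" and n d r t i :: nat and x :: "nat \<Rightarrow> 'a"
  assumes "pair_graph G" and "connected (with_proj G)"
    and "card (pverts G) = n"
    and "diameter G = ereal (real d)"
    and "radius G = ereal (real r)"
    and "t \<ge> 1" and "bij_betw x {1..t} (center G)"
    and "int i \<le> int d - int r"
  shows "distinguishing_number (graph_power G (r + i)) \<ge>
    card {y \<in> pverts G. \<exists>j \<in> {1..t}. 0 \<le> gdist G (x j) y \<and> gdist G (x j) y \<le> ereal (real i)}"
proof (rule card_universal_le_distinguishing_number)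
  show "pair_graph (graph_power G (r + i))"
    using assms(1) by (rule pair_graph_graph_power)
next
  fix y v
  assume y: "y \<in> {y \<in> pverts G. \<exists>j \<in> {1..t}. 0 \<le> gdist G (x j) y \<and> gdist G (x j) y \<le> ereal (real i)}"
    and v: "v \<in> pverts (graph_power G (r + i)) - {y}"
  then obtain j where "j \<in> {1..t}" and le: "gdist G (x j) y \<le> ereal (real i)"
    by auto
  then have "x j \<in> center G"
    using assms(7) by (auto dest: bij_betwE)
  then have "gdist G (x j) v \<le> ereal (real r)"
    using gdist_center_le_radius[OF assms(1)] v assms(5) by (simp add: graph_power_def)
  \<comment> \<open>The route from \<open>y\<close> to \<open>v\<close> passes through the central
    vertex \<open>x j\<close>, at cost at most \<open>i\<close> and then at most
    \<open>r\<close>.\<close>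
  then have "gdist G y v \<le> ereal (real (r + i))"
    using gdist_triangle_le[OF assms(1) le] by blast
  then show "(y, v) \<in> parcs (graph_power G (r + i))"
    \<comment> \<open>Since \<open>v\<close> differs from \<open>y\<close>, their distance is also
      at least 1, as an arc of the power requires.\<close>
    using y v gdist_ge_1[OF assms(1), of y v] by (auto simp: graph_power_def)
qed (auto simp: graph_power_def)

end
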